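(* Let $R$ be a ring, and $\mathcal{P}$ a set of square matrices over $R$ (of arbitrary sizes) satisfying the following four conditions: (1) $\mathcal{P}$ contains every $n\times n$ matrix ($n>0$) that can be written as the product of an $n\times (n-1)$ matrix and an $(n-1)\times n$ matrix over $R$; (2) if $A\in\mathcal{P}$ and $B$ is any square matrix over $R$, then $A\oplus B\in\mathcal{P}$; (3) if $\mathcal{P}$ contains $n\times n$ matrices $A$ and $B$ which agree except in the $r$-th column for some $r$, then it contains their determinantal sum $A\nabla B$ with respect to that column; (4) if $\mathcal{P}$ contains a matrix of the form $A\oplus 1$, where $1$ denotes the $1\times 1$ matrix with entry $1$, then $A\in\mathcal{P}$. Then $\mathcal{P}$ also satisfies (5) if $\mathcal{P}$ contains $n\times n$ matrices $A$ and $B$ which agree except in the $r$-th row for some $r$, then it contains their determinantal sum $A\nabla B$ with respect to that row if and only if it satisfies (6) for each $n>0$, the set of $n\times n$ matrices in $\mathcal{P}$ is closed under left multiplication by the matrices $I_n\pm e_{ij}$ $(i\ne j)$.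
   Context: Rings are associative with $1$, not necessarily commutative. For square matrices $A$, $B$ over $R$, $A\oplus B$ denotes the block-diagonal matrix $\begin{pmatrix}A&0\\0&B\end{pmatrix}$. If $A$ and $B$ are square matrices of the same size which agree except in their $r$-th column (respectively row), their determinantal sum $A\nabla B$ with respect to that column (row) is the matrix which agrees with $A$ and $B$ in all columns (rows) but the $r$-th, and whose $r$-th column (row) is the sum of the $r$-th columns (rows) of $A$ and $B$. $I_n$ is the $n\times n$ identity matrix and $e_{ij}$ the $n\times n$ matrix unit with $1$ in position $(i,j)$ and $0$ elsewhere. *)

theory Defs
  imports "Jordan_Normal_Form.Matrix"
begin

definition direct_sum_mat :: "'a::zero mat \<Rightarrow> 'a mat \<Rightarrow> 'a mat"  (infixr \<open>\<oplus>\<^sub>m\<close> 65) where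
  "A \<oplus>\<^sub>m B = four_block_mat A (0\<^sub>m (dim_row A) (dim_col B)) (0\<^sub>m (dim_row B) (dim_col A)) B"

definition agree_except_col :: "nat \<Rightarrow> 'a mat \<Rightarrow> 'a mat \<Rightarrow> bool" where
  "agree_except_col r A B \<longleftrightarrow> dim_row A = dim_row B \<and> dim_col A = dim_col B \<and>
     (\<forall>j < dim_col A. j \<noteq> r \<longrightarrow> col A j = col B j)"

definition agree_except_row :: "nat \<Rightarrow> 'a mat \<Rightarrow> 'a mat \<Rightarrow> bool" where
  "agree_except_row r A B \<longleftrightarrow> dim_row A = dim_row B \<and> dim_col A = dim_col B \<and>
     (\<forall>i < dim_row A. i \<noteq> r \<longrightarrow> row A i = row B i)"

(* The determinantal sum is a partial operation. The two functions below are total; they have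
   their intended meaning only when A and B agree except in column (row) r. *)

definition det_sum_col :: "nat \<Rightarrow> 'a::plus mat \<Rightarrow> 'a mat \<Rightarrow> 'a mat" where
  "det_sum_col r A B = mat (dim_row A) (dim_col A)
     (\<lambda>(i, j). if j = r then A $$ (i, j) + B $$ (i, j) else A $$ (i, j))"

definition det_sum_row :: "nat \<Rightarrow> 'a::plus mat \<Rightarrow> 'a mat \<Rightarrow> 'a mat" where
  "det_sum_row r A B = mat (dim_row A) (dim_col A)
     (\<lambda>(i, j). if i = r then A $$ (i, j) + B $$ (i, j) else A $$ (i, j))"

definition matrix_unit :: "nat \<Rightarrow> nat \<Rightarrow> nat \<Rightarrow> 'a::{zero,one} mat" where
  "matrix_unit n i j = mat n n (\<lambda>(k, l). if k = i \<and> l = j then 1 else 0)"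

end

theory Submission
  imports Defs
begin

text \<open>
  If \<open>P\<close> is closed under row sums, adding \<open>\<pm>\<close> row \<open>j\<close> to row \<open>i\<close> of a member \<open>A\<close> is the row sum
  of \<open>A\<close> with a matrix having two proportional rows, which factors through size \<open>n - 1\<close>. The same
  argument for columns shows that \<open>P\<close> is always closed under column operations with arbitrary
  coefficients. Conversely, write \<open>a\<close>, \<open>b\<close> for the \<open>r\<close>-th rows of \<open>A\<close>, \<open>B\<close> and \<open>C\<close> for the common
  remaining rows. Enlarged by a last row and column, the matrix with rows \<open>a + b\<close>, \<open>C\<close> is turned by
  admissible operations into the one with rows \<open>(a, -1)\<close>, \<open>(C, 0)\<close>, \<open>(b, 1)\<close>. This is the sum with
  respect to the last column of \<open>(a, 0)\<close>, \<open>(C, 0)\<close>, \<open>(b, 1)\<close>, which comes from \<open>A\<close>, and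
  \<open>(a, -1)\<close>, \<open>(C, 0)\<close>, \<open>(b, 0)\<close>, which comes from \<open>B\<close>.
\<close>

text \<open>The map that skips \<open>p\<close> numbers the indices other than \<open>p\<close> by 0
  to \<open>n - 2\<close>. It turns a sum over these indices into a scalar product of length
  \<open>n - 1\<close>.\<close>

lemma sum_skip_index:
  fixes h :: "nat \<Rightarrow> 'a::comm_monoid_add"
  assumes "p < n"
  shows "(\<Sum>l\<in>{0..<n - 1}. h (if l < p then l else Suc l)) = (\<Sum>m\<in>{0..<n} - {p}. h m)"
proof (rule sum.reindex_bij_witness[where i = "\<lambda>m. if m < p then m else m - 1"
        and j = "\<lambda>l. if l < p then l else Suc l"])
qed (use assms in \<open>auto split: if_splits\<close>)

lemma add_matrix_unit_mult:
  fixes A :: "'a::{ring,monoid_mult} mat"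
  assumes "A \<in> carrier_mat n n" "i < n" "j < n" "i \<noteq> j"
  shows "(1\<^sub>m n + matrix_unit n i j) * A =
    mat n n (\<lambda>(k, l). if k = i then A $$ (i, l) + A $$ (j, l) else A $$ (k, l))"
  using assms
  by (intro eq_matI)
    (auto simp: matrix_unit_def scalar_prod_def distrib_right sum.distrib if_distrib
      [where f = "\<lambda>x. x * _"] cong: if_cong)

lemma diff_matrix_unit_mult:
  fixes A :: "'a::{ring,monoid_mult} mat"
  assumes "A \<in> carrier_mat n n" "i < n" "j < n" "i \<noteq> j"
  shows "(1\<^sub>m n - matrix_unit n i j) * A =
    mat n n (\<lambda>(k, l). if k = i then A $$ (i, l) - A $$ (j, l) else A $$ (k, l))"
  using assms
  by (intro eq_matI)
    (auto simp: matrix_unit_def scalar_prod_def left_diff_distrib sum_subtractf if_distrib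
      [where f = "\<lambda>x. x * _"] cong: if_cong)

text \<open>The last column is a unit vector, so its multiples change nothing but the last row; that
  row \<open>u\<close> can therefore be prescribed freely.\<close>

definition bordered :: "nat \<Rightarrow> (nat \<Rightarrow> nat \<Rightarrow> 'a) \<Rightarrow> (nat \<Rightarrow> 'a) \<Rightarrow> nat \<Rightarrow> nat \<Rightarrow> 'a::{zero,one}" where
  "bordered n f u i j =
    (if i < n then if j < n then f i j else 0 else if j < n then u j else 1)"

lemma direct_sum_one_mat:
  fixes f :: "nat \<Rightarrow> nat \<Rightarrow> 'a::{zero,one}"
  shows "mat n n (\<lambda>(i, j). f i j) \<oplus>\<^sub>m 1\<^sub>m 1 =
    mat (Suc n) (Suc n) (\<lambda>(i, j). bordered n f (\<lambda>_. 0) i j)"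
  by (intro eq_matI) (auto simp: direct_sum_mat_def bordered_def four_block_mat_def Let_def)

text \<open>The sort \<open>{ring,monoid_mult}\<close> does not demand that 0 and 1 differ, so the
  zero ring is covered.\<close>

locale column_matrix_ideal =
  fixes P :: "'a::{ring,monoid_mult} mat set"
  assumes product_mem: "\<And>n X Y. n > 0 \<Longrightarrow> X \<in> carrier_mat n (n - 1) \<Longrightarrow>
      Y \<in> carrier_mat (n - 1) n \<Longrightarrow> X * Y \<in> P"
    and direct_sum_mem: "\<And>A B. A \<in> P \<Longrightarrow> square_mat B \<Longrightarrow> A \<oplus>\<^sub>m B \<in> P"
    and det_sum_col_mem: "\<And>n r A B. A \<in> carrier_mat n n \<Longrightarrow> B \<in> carrier_mat n n \<Longrightarrow> A \<in> P \<Longrightarrow>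
      B \<in> P \<Longrightarrow> r < n \<Longrightarrow> agree_except_col r A B \<Longrightarrow> det_sum_col r A B \<in> P"
    and direct_sum_one_cancel: "\<And>A. square_mat A \<Longrightarrow> A \<oplus>\<^sub>m 1\<^sub>m 1 \<in> P \<Longrightarrow> A \<in> P"
begin

text \<open>Membership is stated for entry functions, so that row and column operations become case
  distinctions on indices.\<close>

definition mem :: "nat \<Rightarrow> (nat \<Rightarrow> nat \<Rightarrow> 'a) \<Rightarrow> bool" where
  "mem n f \<longleftrightarrow> mat n n (\<lambda>(i, j). f i j) \<in> P"

lemma mem_cong:
  assumes "mem n f" "\<And>i j. i < n \<Longrightarrow> j < n \<Longrightarrow> f i j = g i j"
  shows "mem n g"
proof -
  have "mat n n (\<lambda>(i, j). f i j) = mat n n (\<lambda>(i, j). g i j)"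
    using assms(2) by (intro eq_matI) auto
  with assms(1) show ?thesis by (simp add: mem_def)
qed

lemma mem_carrier: "A \<in> carrier_mat n n \<Longrightarrow> mem n (\<lambda>i j. A $$ (i, j)) \<longleftrightarrow> A \<in> P"
proof -
  assume "A \<in> carrier_mat n n"
  then have "mat n n (\<lambda>(i, j). A $$ (i, j)) = A"
    by (intro eq_matI) auto
  then show ?thesis by (simp add: mem_def)
qed

text \<open>The inner index runs over \<open>n - 1\<close> values. Keeping \<open>p\<close> as the
  omitted one allows \<open>f\<close> itself to serve as one of the factors.\<close>

lemma mem_not_full:
  assumes "p < n"
    and fac: "\<And>i j. i < n \<Longrightarrow> j < n \<Longrightarrow> f i j = (\<Sum>m\<in>{0..<n} - {p}. x i m * y m j)"
  shows "mem n f"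
proof -
  let ?s = "\<lambda>l. if l < p then l else Suc l"
  let ?X = "mat n (n - 1) (\<lambda>(i, l). x i (?s l))"
  let ?Y = "mat (n - 1) n (\<lambda>(l, j). y (?s l) j)"
  have "mat n n (\<lambda>(i, j). f i j) = ?X * ?Y"
  proof (intro eq_matI)
    fix i j assume "i < dim_row (?X * ?Y)" "j < dim_col (?X * ?Y)"
    then have ij: "i < n" "j < n" by auto
    then have "(?X * ?Y) $$ (i, j) = (\<Sum>l\<in>{0..<n - 1}. x i (?s l) * y (?s l) j)"
      by (simp add: scalar_prod_def)
    also have "\<dots> = f i j"
      using sum_skip_index[OF assms(1), of "\<lambda>m. x i m * y m j"] fac[OF ij] by simp
    finally show "mat n n (\<lambda>(i, j). f i j) $$ (i, j) = (?X * ?Y) $$ (i, j)"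
      using ij by simp
  qed auto
  then show ?thesis
    using product_mem[of n ?X ?Y] assms(1) by (simp add: mem_def)
qed

lemma mem_proportional_cols:
  assumes "p < n" "q < n" "p \<noteq> q" "\<And>i. i < n \<Longrightarrow> f i p = f i q * c"
  shows "mem n f"
\<comment> \<open>The left factor is \<open>f\<close> without column \<open>p\<close>; the right one
  copies the other columns and restores column \<open>p\<close> as \<open>c\<close> times column
  \<open>q\<close>, with \<open>c\<close> on the right.\<close>
proof (rule mem_not_full[where p = p and x = f
      and y = "\<lambda>m j. if j = p then if m = q then c else 0 else if m = j then 1 else 0"])
  fix i j assume "i < n" "j < n"
  then show "f i j = (\<Sum>m\<in>{0..<n} - {p}. f i m *
      (if j = p then if m = q then c else 0 else if m = j then 1 else 0))"
    using assms by (cases "j = p") (auto simp: if_distrib[where f = "\<lambda>x. _ * x"] cong: if_cong)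
qed (fact assms(1))

lemma mem_proportional_rows:
  assumes "p < n" "q < n" "p \<noteq> q" "\<And>j. j < n \<Longrightarrow> f p j = c * f q j"
  shows "mem n f"
proof (rule mem_not_full[where p = p and y = f
      and x = "\<lambda>i m. if i = p then if m = q then c else 0 else if i = m then 1 else 0"])
  fix i j assume "i < n" "j < n"
  then show "f i j = (\<Sum>m\<in>{0..<n} - {p}.
      (if i = p then if m = q then c else 0 else if i = m then 1 else 0) * f m j)"
    using assms by (cases "i = p") (auto simp: if_distrib[where f = "\<lambda>x. x * _"] cong: if_cong)
qed (fact assms(1))

lemma mem_col_sum:
  assumes "mem n f" "mem n g" "r < n"
    and agree: "\<And>i j. i < n \<Longrightarrow> j < n \<Longrightarrow> j \<noteq> r \<Longrightarrow> f i j = g i j"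
  shows "mem n (\<lambda>i j. if j = r then f i j + g i j else f i j)"
proof -
  let ?A = "mat n n (\<lambda>(i, j). f i j)" and ?B = "mat n n (\<lambda>(i, j). g i j)"
  have "agree_except_col r ?A ?B"
    using agree by (auto simp: agree_except_col_def intro!: eq_vecI)
  then have "det_sum_col r ?A ?B \<in> P"
    using det_sum_col_mem[of ?A n ?B r] assms(1-3) by (simp add: mem_def)
  moreover have "det_sum_col r ?A ?B = mat n n (\<lambda>(i, j). if j = r then f i j + g i j else f i j)"
    by (intro eq_matI) (auto simp: det_sum_col_def)
  ultimately show ?thesis by (simp add: mem_def)
qed

lemma mem_add_col:
  assumes "mem n f" "p < n" "q < n" "p \<noteq> q"
  shows "mem n (\<lambda>i j. if j = q then f i j + f i p * c else f i j)"
proof -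
  let ?g = "\<lambda>i j. if j = q then f i p * c else f i j"
  have "mem n ?g"
    by (rule mem_proportional_cols[of q n p]) (use assms in auto)
  from mem_col_sum[OF assms(1) this assms(3)] show ?thesis
    by (rule mem_cong) auto
qed

text \<open>Column \<open>p\<close> stays fixed because \<open>p\<close> \<notin> \<open>S\<close>,
  so the columns of \<open>S\<close> can be treated one after another.\<close>

lemma mem_add_cols:
  assumes "mem n f" "p < n" "finite S" "S \<subseteq> {0..<n} - {p}"
  shows "mem n (\<lambda>i j. if j \<in> S then f i j + f i p * u j else f i j)"
  using assms(3,4)
proof (induction S rule: finite_induct)
  case empty
  then show ?case using assms(1) by simp
next
  case (insert q S)
  then have IH: "mem n (\<lambda>i j. if j \<in> S then f i j + f i p * u j else f i j)"
    by simp
  have "p \<noteq> q" "q < n" using insert.prems by auto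
  from mem_add_col[OF IH assms(2) this(2,1), of "u q"] show ?case
    by (rule mem_cong) (use insert.hyps insert.prems in auto)
qed

lemma mem_bordered: "mem (Suc n) (bordered n f u) \<longleftrightarrow> mem n f"
proof -
  \<comment> \<open>Adding last column times \<open>w j - v j\<close> to each column
    \<open>j < n\<close> replaces the border \<open>v\<close> by \<open>w\<close>. It remains to
    treat the zero border, which is the direct sum with 1.\<close>
  have change: "mem (Suc n) (bordered n f w)" if "mem (Suc n) (bordered n f v)" for v w
    by (rule mem_cong[OF mem_add_cols[OF that, of n "{0..<n}" "\<lambda>j. w j - v j"]])
      (auto simp: bordered_def)
  have "mem (Suc n) (bordered n f (\<lambda>_. 0)) \<longleftrightarrow> mem n f"
    using direct_sum_mem[of "mat n n (\<lambda>(i, j). f i j)" "1\<^sub>m 1"]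
      direct_sum_one_cancel[of "mat n n (\<lambda>(i, j). f i j)"]
    unfolding mem_def direct_sum_one_mat[symmetric] by auto
  then show ?thesis using change by blast
qed

text \<open>The operations \<open>add\<close> and \<open>sub\<close> are assumed in every size,
  since they are applied to bordered matrices of size \<open>Suc n\<close>.\<close>

lemma mem_row_sum:
  assumes add: "\<And>m h p q. mem m h \<Longrightarrow> p < m \<Longrightarrow> q < m \<Longrightarrow> p \<noteq> q \<Longrightarrow>
      mem m (\<lambda>i j. if i = p then h p j + h q j else h i j)"
    and sub: "\<And>m h p q. mem m h \<Longrightarrow> p < m \<Longrightarrow> q < m \<Longrightarrow> p \<noteq> q \<Longrightarrow>
      mem m (\<lambda>i j. if i = p then h p j - h q j else h i j)"
    and "mem n f" "mem n g" "r < n"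
    and agree: "\<And>i j. i < n \<Longrightarrow> j < n \<Longrightarrow> i \<noteq> r \<Longrightarrow> f i j = g i j"
  shows "mem n (\<lambda>i j. if i = r then f i j + g i j else f i j)"
proof -
  let ?N = "Suc n"
  have r: "r < ?N" "n < ?N" "r \<noteq> n" "n \<noteq> r" using assms(5) by auto
  let ?F = "bordered n f (g r)"
  let ?G = "\<lambda>i j. if j = n then if i = r then - 1 else 0 else ?F i j"
  have F: "mem ?N ?F" using mem_bordered assms(3) by blast
  \<comment> \<open>The border is \<open>- f r\<close> because its negative is to become row
    \<open>r\<close> of \<open>?G\<close>; the corner entry 1 then yields the -1 there.\<close>
  have "mem ?N (bordered n g (\<lambda>j. - f r j))" using mem_bordered assms(4) by blast
  \<comment> \<open>these three operations turn rows \<open>r\<close> and \<open>n\<close> into \<open>-\<close> row \<open>n\<close> and row \<open>r\<close>\<close>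
  from sub[OF add[OF sub[OF this r(1-3)] r(2,1,4)] r(1-3)]
  have "mem ?N ?G"
    by (rule mem_cong) (use r agree in \<open>auto simp: bordered_def\<close>)
  \<comment> \<open>The column sum has -1 in row \<open>r\<close> and 1 in row \<open>n\<close> of
    its last column. Adding row \<open>n\<close> to row \<open>r\<close> cancels the -1 and produces
    \<open>f r + g r\<close>, leaving a bordered matrix.\<close>
  from add[OF mem_col_sum[OF F this r(2)] r(1-3)]
  have "mem ?N (bordered n (\<lambda>i j. if i = r then f i j + g i j else f i j) (g r))"
    by (rule mem_cong) (use r in \<open>auto simp: bordered_def\<close>)
  then show ?thesis using mem_bordered by blast
qed

lemma row_sum_closed_iff_row_op_closed:
  "(\<forall>n r A B. A \<in> carrier_mat n n \<longrightarrow> B \<in> carrier_mat n n \<longrightarrow> A \<in> P \<longrightarrow> B \<in> P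
       \<longrightarrow> r < n \<longrightarrow> agree_except_row r A B \<longrightarrow> det_sum_row r A B \<in> P)
   \<longleftrightarrow>
   (\<forall>n > 0. \<forall>A \<in> carrier_mat n n. A \<in> P
       \<longrightarrow> (\<forall>i < n. \<forall>j < n. i \<noteq> j
             \<longrightarrow> (1\<^sub>m n + matrix_unit n i j) * A \<in> P
               \<and> (1\<^sub>m n - matrix_unit n i j) * A \<in> P))"
  (is "?row_sum \<longleftrightarrow> ?row_op")
proof
  assume row_sum: ?row_sum
  \<comment> \<open>A general coefficient \<open>c\<close> handles both signs at once, by
    \<open>c = 1\<close> and \<open>c = - 1\<close>.\<close>
  have row_op: "mat n n (\<lambda>(k, l). if k = i then A $$ (i, l) + c * A $$ (j, l) else A $$ (k, l)) \<in> P"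
    if A: "A \<in> carrier_mat n n" "A \<in> P" and ij: "i < n" "j < n" "i \<noteq> j" for n A i j c
  proof -
    let ?B = "mat n n (\<lambda>(k, l). if k = i then c * A $$ (j, l) else A $$ (k, l))"
    have "mem n (\<lambda>k l. if k = i then c * A $$ (j, l) else A $$ (k, l))"
      by (rule mem_proportional_rows[of i n j]) (use ij in auto)
    then have "?B \<in> P" by (simp add: mem_def)
    moreover have "agree_except_row i A ?B"
      using A by (auto simp: agree_except_row_def intro!: eq_vecI)
    ultimately have "det_sum_row i A ?B \<in> P"
      using row_sum[rule_format, of A n ?B i] A ij by auto
    moreover have "det_sum_row i A ?B =
        mat n n (\<lambda>(k, l). if k = i then A $$ (i, l) + c * A $$ (j, l) else A $$ (k, l))"
      using A ij by (intro eq_matI) (auto simp: det_sum_row_def)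
    ultimately show ?thesis by simp
  qed
  show ?row_op
  proof (intro allI ballI impI)
    fix n i j and A :: "'a mat"
    assume A: "A \<in> carrier_mat n n" "A \<in> P" and ij: "i < n" "j < n" "i \<noteq> j"
    show "(1\<^sub>m n + matrix_unit n i j) * A \<in> P \<and> (1\<^sub>m n - matrix_unit n i j) * A \<in> P"
      using row_op[OF A ij, of 1] row_op[OF A ij, of "- 1"]
      by (simp add: add_matrix_unit_mult[OF A(1) ij] diff_matrix_unit_mult[OF A(1) ij]
          cong: if_cong)
  qed
next
  assume row_op: ?row_op
  have add: "mem m (\<lambda>i j. if i = p then h p j + h q j else h i j)"
    and sub: "mem m (\<lambda>i j. if i = p then h p j - h q j else h i j)"
    if "mem m h" "p < m" "q < m" "p \<noteq> q" for m h p q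
  proof -
    let ?A = "mat m m (\<lambda>(i, j). h i j)"
    have A: "?A \<in> carrier_mat m m" by simp
    have "mat m m (\<lambda>(i, j). if i = p then ?A $$ (p, j) + ?A $$ (q, j) else ?A $$ (i, j)) \<in> P"
      "mat m m (\<lambda>(i, j). if i = p then ?A $$ (p, j) - ?A $$ (q, j) else ?A $$ (i, j)) \<in> P"
      using row_op[rule_format, OF _ A _ that(2-4)] that
      unfolding add_matrix_unit_mult[OF A that(2-4)] diff_matrix_unit_mult[OF A that(2-4)]
      by (auto simp: mem_def)
    then have add: "mem m (\<lambda>i j. if i = p then ?A $$ (p, j) + ?A $$ (q, j) else ?A $$ (i, j))"
      and sub: "mem m (\<lambda>i j. if i = p then ?A $$ (p, j) - ?A $$ (q, j) else ?A $$ (i, j))"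
      by (auto simp: mem_def)
    from add show "mem m (\<lambda>i j. if i = p then h p j + h q j else h i j)"
      by (rule mem_cong) (use that in auto)
    from sub show "mem m (\<lambda>i j. if i = p then h p j - h q j else h i j)"
      by (rule mem_cong) (use that in auto)
  qed
  show ?row_sum
  proof (intro allI impI)
    fix n r and A B :: "'a mat"
    assume A: "A \<in> carrier_mat n n" and B: "B \<in> carrier_mat n n" and P: "A \<in> P" "B \<in> P"
      and r: "r < n" and agree: "agree_except_row r A B"
    have "A $$ (i, j) = B $$ (i, j)" if "i < n" "j < n" "i \<noteq> r" for i j
    proof -
      have "row A i $ j = row B i $ j"
        using agree that A by (auto simp: agree_except_row_def)
      then show ?thesis using that A B by auto
    qed
    with mem_row_sum[OF add sub, of n "\<lambda>i j. A $$ (i, j)" "\<lambda>i j. B $$ (i, j)" r] A B P r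
    have "mem n (\<lambda>i j. if i = r then A $$ (i, j) + B $$ (i, j) else A $$ (i, j))"
      by (simp add: mem_carrier)
    then show "det_sum_row r A B \<in> P"
      using A by (simp add: mem_def det_sum_row_def)
  qed
qed

end

theorem lemma18:
  fixes P :: "'a::{ring,monoid_mult} mat set"
  assumes square: "\<And>A. A \<in> P \<Longrightarrow> square_mat A"
    and cond1: "\<And>n X Y. n > 0 \<Longrightarrow> X \<in> carrier_mat n (n - 1) \<Longrightarrow> Y \<in> carrier_mat (n - 1) n
                  \<Longrightarrow> X * Y \<in> P"
    and cond2: "\<And>A B. A \<in> P \<Longrightarrow> square_mat B \<Longrightarrow> A \<oplus>\<^sub>m B \<in> P"
    and cond3: "\<And>n r A B. A \<in> carrier_mat n n \<Longrightarrow> B \<in> carrier_mat n n \<Longrightarrow> A \<in> P \<Longrightarrow> B \<in> P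
                  \<Longrightarrow> r < n \<Longrightarrow> agree_except_col r A B \<Longrightarrow> det_sum_col r A B \<in> P"
    and cond4: "\<And>A. square_mat A \<Longrightarrow> A \<oplus>\<^sub>m 1\<^sub>m 1 \<in> P \<Longrightarrow> A \<in> P"
  shows "(\<forall>n r A B. A \<in> carrier_mat n n \<longrightarrow> B \<in> carrier_mat n n \<longrightarrow> A \<in> P \<longrightarrow> B \<in> P
             \<longrightarrow> r < n \<longrightarrow> agree_except_row r A B \<longrightarrow> det_sum_row r A B \<in> P)
         \<longleftrightarrow>
         (\<forall>n > 0. \<forall>A \<in> carrier_mat n n. A \<in> P
             \<longrightarrow> (\<forall>i < n. \<forall>j < n. i \<noteq> j
                   \<longrightarrow> (1\<^sub>m n + matrix_unit n i j) * A \<in> P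
                     \<and> (1\<^sub>m n - matrix_unit n i j) * A \<in> P))"
proof -
  interpret column_matrix_ideal P
    by unfold_locales (fact cond1 cond2 cond3 cond4)+
  show ?thesis
    by (rule row_sum_closed_iff_row_op_closed)
qed

end
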